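(* Let $x: I\subset\mathbb{R}\to E_1^4$ be a unit speed spacelike curve in Minkowski 4-space with Frenet frame $\{T,N,B_1,B_2\}$, nowhere vanishing curvatures $k_1(s),k_2(s),k_3(s)$, and $\varepsilon_1=\langle N,N\rangle\in\{+1,-1\}$. Then $x$ is a (spacelike) $B_2$-slant helix if and only if there exists a $C^2$-function $f: I\to\mathbb{R}$ such that, on $I$, $$f(s)\,k_1(s)=\varepsilon_1\frac{d}{ds}\left(\frac{k_3}{k_2}\right)(s),\qquad \frac{d}{ds}f(s)=-k_1(s)\frac{k_3(s)}{k_2(s)} .$$
   Context: Minkowski 4-space $E_1^4$ is $\mathbb{R}^4$ with the metric $\langle\,,\rangle=-dx_1^2+dx_2^2+dx_3^2+dx_4^2$. A vector $v$ is spacelike if $\langle v,v\rangle>0$ or $v=0$, timelike if $\langle v,v\rangle<0$, and lightlike if $\langle v,v\rangle=0$ and $v\ne 0$. A curve $x$ is unit speed spacelike if $\langle x'(s),x'(s)\rangle=1$ for all $s$. Curves and curvature functions are assumed sufficiently differentiable, with $I$ an interval. The Frenet frame $\{T,N,B_1,B_2\}$ along $x$ (tangent $T=x'$, principal normal, first binormal, second binormal) is a frame of mutually orthogonal vector fields with $\langle T,T\rangle=1$, $\langle N,N\rangle=\varepsilon_1$, $\langle B_2,B_2\rangle=\varepsilon_2$, $\langle B_1,B_1\rangle=-\varepsilon_1\varepsilon_2$, where $(\varepsilon_1,\varepsilon_2)\in\{(1,1),(1,-1),(-1,1)\}$, satisfying $$T'=k_1N,\quad N'=-\varepsilon_1k_1T+k_2B_1,\quad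 B_1'=\varepsilon_2k_2N+k_3B_2,\quad B_2'=\varepsilon_1k_3B_1 .$$ The functions $k_1,k_2,k_3$ are the first, second and third curvatures; it is assumed that $k_i(s)\neq0$ for all $s$ and $i=1,2,3$. The curve $x$ is called a spacelike $B_2$-slant helix if $B_2$ makes a constant angle with a fixed direction given by a "unit" vector $U$, that is, if there is a fixed (constant) vector $U$ with $\langle B_2(s),U\rangle$ constant along the curve. Here $U\neq 0$ may be spacelike, timelike or lightlike, with $\langle U,U\rangle=+1,-1$ or $0$ respectively. *)

theory Defs
  imports "HOL-Analysis.Analysis"
begin

(* Minkowski 4-space is modelled on the type real^4; the coordinate with index 1 carries
   the minus sign.  On the Euclidean side only the topology of real^4 is used. *)
definition mink :: "real^4 \<Rightarrow> real^4 \<Rightarrow> real" where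
  "mink v w = - (v$1 * w$1) + v$2 * w$2 + v$3 * w$3 + v$4 * w$4"

(* C^n on an arbitrary interval: derivatives are taken within I, i.e. they are one-sided
   at those endpoints that belong to I. *)
fun Cn_on :: "nat \<Rightarrow> (real \<Rightarrow> real) \<Rightarrow> real set \<Rightarrow> bool" where
  "Cn_on 0 f I \<longleftrightarrow> continuous_on I f"
| "Cn_on (Suc n) f I \<longleftrightarrow>
     (\<exists>f'. (\<forall>s\<in>I. (f has_real_derivative f' s) (at s within I)) \<and> Cn_on n f' I)"

definition unit_speed_spacelike :: "real set \<Rightarrow> (real \<Rightarrow> real^4) \<Rightarrow> bool" where
  "unit_speed_spacelike I x \<longleftrightarrow>
     x differentiable_on I \<and>
     (\<forall>s\<in>I. mink (vector_derivative x (at s within I)) (vector_derivative x (at s within I)) = 1)"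

(* e1 and e2 are the causal characters of N and B2.  The three admissible pairs are those for
   which exactly one of N, B1, B2 is timelike. *)
definition frenet_frame ::
  "real set \<Rightarrow> (real \<Rightarrow> real^4) \<Rightarrow>
   (real \<Rightarrow> real^4) \<Rightarrow> (real \<Rightarrow> real^4) \<Rightarrow> (real \<Rightarrow> real^4) \<Rightarrow> (real \<Rightarrow> real^4) \<Rightarrow>
   (real \<Rightarrow> real) \<Rightarrow> (real \<Rightarrow> real) \<Rightarrow> (real \<Rightarrow> real) \<Rightarrow> real \<Rightarrow> real \<Rightarrow> bool" where
  "frenet_frame I x T N B1 B2 k1 k2 k3 e1 e2 \<longleftrightarrow>
     (e1, e2) \<in> {(1, 1), (1, - 1), (- 1, 1)} \<and>
     (\<forall>s\<in>I.
        mink (T s) (T s) = 1 \<and> mink (N s) (N s) = e1 \<and>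
        mink (B1 s) (B1 s) = - e1 * e2 \<and> mink (B2 s) (B2 s) = e2 \<and>
        mink (T s) (N s) = 0 \<and> mink (T s) (B1 s) = 0 \<and> mink (T s) (B2 s) = 0 \<and>
        mink (N s) (B1 s) = 0 \<and> mink (N s) (B2 s) = 0 \<and> mink (B1 s) (B2 s) = 0 \<and>
        (x has_vector_derivative T s) (at s within I) \<and>
        (T has_vector_derivative k1 s *\<^sub>R N s) (at s within I) \<and>
        (N has_vector_derivative (- e1 * k1 s) *\<^sub>R T s + k2 s *\<^sub>R B1 s) (at s within I) \<and>
        (B1 has_vector_derivative (e2 * k2 s) *\<^sub>R N s + k3 s *\<^sub>R B2 s) (at s within I) \<and>
        (B2 has_vector_derivative (e1 * k3 s) *\<^sub>R B1 s) (at s within I))"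

(* The axis U may be spacelike, timelike or lightlike; "unit" means that mink U U is
   1, -1 or 0 respectively.  "Constant angle" means that mink (B2 s) U is constant. *)
definition B2_slant_helix :: "real set \<Rightarrow> (real \<Rightarrow> real^4) \<Rightarrow> bool" where
  "B2_slant_helix I B2 \<longleftrightarrow>
     (\<exists>U. U \<noteq> 0 \<and> mink U U \<in> {1, - 1, 0} \<and> (\<exists>c. \<forall>s\<in>I. mink (B2 s) U = c))"

end

theory Submission imports Defs begin

text \<open>
  Pair a fixed vector \<open>U\<close> with the Frenet frame: \<open>t = \<langle>T,U\<rangle>\<close>, \<open>n = \<langle>N,U\<rangle>\<close>, \<open>b = \<langle>B\<^sub>1,U\<rangle>\<close>,
  \<open>c = \<langle>B\<^sub>2,U\<rangle>\<close>.  The Frenet equations turn into a linear system for these functions, and if \<open>c\<close>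
  is constant that system can be solved from the bottom up:  \<open>c' = 0\<close> gives \<open>b = 0\<close>, then
  \<open>b' = 0\<close> gives \<open>n = - \<epsilon>\<^sub>2 c (k\<^sub>3/k\<^sub>2)\<close>, and \<open>n' = - \<epsilon>\<^sub>1 k\<^sub>1 t\<close> and \<open>t' = k\<^sub>1 n\<close> become
  \<open>k\<^sub>1 t = \<epsilon>\<^sub>1 \<epsilon>\<^sub>2 c (k\<^sub>3/k\<^sub>2)'\<close> and \<open>t' = - \<epsilon>\<^sub>2 c k\<^sub>1 (k\<^sub>3/k\<^sub>2)\<close>.  Up to the factor \<open>\<epsilon>\<^sub>2 c\<close> these are the
  two equations required of \<open>f\<close>, so \<open>f = \<epsilon>\<^sub>2 t / c\<close> works once \<open>c \<noteq> 0\<close>.  If \<open>c\<close> were \<open>0\<close>, then \<open>U\<close>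
  would be orthogonal to the whole frame, which forces \<open>U = 0\<close> since the frame is a basis and the
  metric is nondegenerate (\<open>mink_orthogonal_frame_eq_0\<close>).

  Conversely, reading off the components of \<open>U\<close> from this solution with \<open>c = \<epsilon>\<^sub>2\<close> suggests the field
  \<open>f T - \<epsilon>\<^sub>1 (k\<^sub>3/k\<^sub>2) N + B\<^sub>2\<close>.  The two equations for \<open>f\<close> say exactly that its derivative vanishes,
  so it is a constant vector, and its product with \<open>B\<^sub>2\<close> is \<open>\<epsilon>\<^sub>2 \<noteq> 0\<close>.  Scaling makes it a unit
  vector.
\<close>

section \<open>The Minkowski product\<close>

lemma mink_commute: "mink v w = mink w v"
  by (simp add: mink_def mult.commute)

lemma bounded_linear_mink_left: "bounded_linear (\<lambda>v. mink v U)"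
proof -
  have "linear (\<lambda>v. mink v U)"
    by (rule linearI) (simp_all add: mink_def algebra_simps)
  then show ?thesis
    by (simp add: linear_conv_bounded_linear)
qed

lemmas mink_left_simps =
  bounded_linear.axioms(1)[OF bounded_linear_mink_left, THEN linear_0]
  bounded_linear.axioms(1)[OF bounded_linear_mink_left, THEN linear_add]
  bounded_linear.axioms(1)[OF bounded_linear_mink_left, THEN linear_diff]
  bounded_linear.axioms(1)[OF bounded_linear_mink_left, THEN linear_scale]

lemma mink_scaleR_right: "mink v (a *\<^sub>R w) = a * mink v w"
  by (simp add: mink_def algebra_simps)

lemma has_real_derivative_mink_left:
  assumes "(X has_vector_derivative D) F"
  shows "((\<lambda>s. mink (X s) U) has_real_derivative mink D U) F"
  using bounded_linear.has_vector_derivative[OF bounded_linear_mink_left assms, of U]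
  by (simp add: has_real_derivative_iff_has_vector_derivative)

text \<open>Testing against the reflection of \<open>U\<close> in the hyperplane \<open>x\<^sub>1 = 0\<close> gives the Euclidean square
  of \<open>U\<close>.\<close>
lemma mink_nondegenerate:
  assumes "\<And>v. mink v U = 0"
  shows "U = 0"
proof -
  have "mink (\<chi> i. if i = 1 then - U$1 else U$i) U = U \<bullet> U"
    by (simp add: mink_def inner_vec_def sum_4)
  with assms show ?thesis by simp
qed

text \<open>A linear relation is tested against its own vectors: the coefficient of \<open>v\<close> survives only in
  the product with \<open>v\<close>, where it is multiplied by \<open>\<langle>v,v\<rangle> \<noteq> 0\<close>.\<close>
lemma mink_orthogonal_independent:
  assumes "finite S"
    and nonnull: "\<And>v. v \<in> S \<Longrightarrow> mink v v \<noteq> 0"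
    and orth: "\<And>v w. v \<in> S \<Longrightarrow> w \<in> S \<Longrightarrow> v \<noteq> w \<Longrightarrow> mink v w = 0"
  shows "independent S"
proof (rule independent_if_scalars_zero[OF \<open>finite S\<close>])
  fix u w assume sum0: "(\<Sum>v\<in>S. u v *\<^sub>R v) = 0" and w: "w \<in> S"
  have "0 = mink (\<Sum>v\<in>S. u v *\<^sub>R v) w"
    by (simp add: sum0 mink_left_simps)
  also have "\<dots> = (\<Sum>v\<in>S. u v * mink v w)"
    by (subst linear_sum[OF bounded_linear.axioms(1)[OF bounded_linear_mink_left]])
      (simp add: mink_left_simps)
  also have "\<dots> = (\<Sum>v\<in>S. if v = w then u w * mink w w else 0)"
    by (rule sum.cong) (use orth w in auto)
  also have "\<dots> = u w * mink w w"
    using \<open>finite S\<close> w by simp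
  finally show "u w = 0"
    using nonnull[OF w] by simp
qed

text \<open>Distinct members of the list are distinct vectors, since a repetition would be a null vector.
  So they are four independent vectors in a space of dimension four, and orthogonality to \<open>U\<close>
  spreads from them to the whole space.\<close>
lemma mink_orthogonal_frame_eq_0:
  fixes a b c d U :: "real^4"
  assumes nonnull: "mink a a \<noteq> 0" "mink b b \<noteq> 0" "mink c c \<noteq> 0" "mink d d \<noteq> 0"
    and orth: "mink a b = 0" "mink a c = 0" "mink a d = 0" "mink b c = 0" "mink b d = 0" "mink c d = 0"
    and U: "mink a U = 0" "mink b U = 0" "mink c U = 0" "mink d U = 0"
  shows "U = 0"
proof (rule mink_nondegenerate)
  fix v
  let ?S = "{a, b, c, d}"
  have "independent ?S"
    by (rule mink_orthogonal_independent) (use nonnull orth mink_commute in auto)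
  moreover have "card ?S = dim (UNIV :: (real^4) set)"
    using nonnull orth by (auto simp: card_insert_if)
  ultimately have "v \<in> span ?S"
    using card_ge_dim_independent[of ?S UNIV] by auto
  then show "mink v U = 0"
    by (rule span_induct_alt) (use U in \<open>auto simp: mink_left_simps\<close>)
qed

lemma mink_normalise:
  assumes "V \<noteq> 0"
  obtains a where "a *\<^sub>R V \<noteq> 0" and "mink (a *\<^sub>R V) (a *\<^sub>R V) \<in> {1, - 1, 0}"
proof (cases "mink V V = 0")
  case True
  then show ?thesis
    using that[of 1] assms by simp
next
  case False
  define a where "a = 1 / sqrt \<bar>mink V V\<bar>"
  have "mink (a *\<^sub>R V) (a *\<^sub>R V) = mink V V / \<bar>mink V V\<bar>"
    by (simp add: a_def mink_left_simps mink_scaleR_right divide_simps)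
  also have "\<dots> \<in> {1, - 1, 0}"
    by (auto simp: abs_if)
  finally show ?thesis
    using that[of a] False assms by (simp add: a_def)
qed

section \<open>Derivatives on an interval\<close>

text \<open>An interval with interior accumulates at each of its points, the endpoints included; this is
  what makes one-sided derivatives at the endpoints unique.\<close>
lemma interval_at_within_nontrivial:
  fixes I :: "real set"
  assumes "is_interval I" "interior I \<noteq> {}" "s \<in> I"
  shows "at s within I \<noteq> bot"
proof -
  have "I \<noteq> {a}" for a
    using assms(2) by auto
  then have "s islimpt I"
    using assms connected_imp_perfect is_interval_connected by blast
  then show ?thesis
    by (simp add: trivial_limit_within)
qed

lemma has_real_derivative_within_unique:
  fixes g :: "real \<Rightarrow> real"
  assumes "at s within I \<noteq> bot"
    and "(g has_real_derivative a) (at s within I)" "(g has_real_derivative b) (at s within I)"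
  shows "a = b"
  using assms
  by (auto simp: has_real_derivative_iff_has_vector_derivative intro: vector_derivative_unique_within)

lemma Cn_on_1_iff:
  "Cn_on 1 g I \<longleftrightarrow>
    (\<exists>g'. (\<forall>s\<in>I. (g has_real_derivative g' s) (at s within I)) \<and> continuous_on I g')"
  by (simp add: One_nat_def)

lemma Cn_on_1_continuous_on: "Cn_on 1 g I \<Longrightarrow> continuous_on I g"
  by (auto simp: Cn_on_1_iff continuous_on_eq_continuous_within intro: DERIV_continuous)

lemma Cn_on_1_mult:
  assumes "Cn_on 1 g I" "Cn_on 1 h I"
  shows "Cn_on 1 (\<lambda>s. g s * h s) I"
proof -
  from assms obtain g' h' where
    g': "\<forall>s\<in>I. (g has_real_derivative g' s) (at s within I)" "continuous_on I g'" and
    h': "\<forall>s\<in>I. (h has_real_derivative h' s) (at s within I)" "continuous_on I h'"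
    by (auto simp: Cn_on_1_iff)
  have "\<forall>s\<in>I. ((\<lambda>s. g s * h s) has_real_derivative g' s * h s + h' s * g s) (at s within I)"
    using g' h' DERIV_mult by blast
  moreover have "continuous_on I (\<lambda>s. g' s * h s + h' s * g s)"
    by (intro continuous_intros g' h' assms Cn_on_1_continuous_on)
  ultimately show ?thesis
    unfolding Cn_on_1_iff by (intro exI[of _ "\<lambda>s. g' s * h s + h' s * g s"]) simp
qed

lemma Cn_on_1_inverse:
  assumes "Cn_on 1 g I" and nz: "\<And>s. s \<in> I \<Longrightarrow> g s \<noteq> 0"
  shows "Cn_on 1 (\<lambda>s. inverse (g s)) I"
proof -
  from assms obtain g' where
    g': "\<forall>s\<in>I. (g has_real_derivative g' s) (at s within I)" "continuous_on I g'"
    by (auto simp: Cn_on_1_iff)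
  let ?d = "\<lambda>s. - (inverse (g s) * g' s * inverse (g s))"
  have "\<forall>s\<in>I. ((\<lambda>s. inverse (g s)) has_real_derivative ?d s) (at s within I)"
    using g' nz DERIV_inverse' by blast
  moreover have "continuous_on I ?d"
    by (intro continuous_intros g' assms Cn_on_1_continuous_on) (use nz in auto)
  ultimately show ?thesis
    unfolding Cn_on_1_iff by (intro exI[of _ ?d]) simp
qed

lemma Cn_on_2I:
  assumes "\<And>s. s \<in> I \<Longrightarrow> (g has_real_derivative g' s) (at s within I)" "Cn_on 1 g' I"
  shows "Cn_on 2 g I"
  using assms by (auto simp: numeral_2_eq_2 One_nat_def simp del: Cn_on.simps(1))

section \<open>Slant helices\<close>

theorem theorem3p2:
  fixes I :: "real set"
    and x T N B1 B2 :: "real \<Rightarrow> real^4"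
    and k1 k2 k3 :: "real \<Rightarrow> real"
    and e1 e2 :: real
  assumes "is_interval I" and "interior I \<noteq> {}"
    and "unit_speed_spacelike I x"
    and "frenet_frame I x T N B1 B2 k1 k2 k3 e1 e2"
    and "Cn_on 1 k1 I" and "Cn_on 1 k2 I" and "Cn_on 1 k3 I"
    and "\<And>s. s \<in> I \<Longrightarrow> k1 s \<noteq> 0 \<and> k2 s \<noteq> 0 \<and> k3 s \<noteq> 0"
  shows "B2_slant_helix I B2 \<longleftrightarrow>
    (\<exists>f :: real \<Rightarrow> real. Cn_on 2 f I \<and>
       (\<forall>s\<in>I. f s * k1 s = e1 * vector_derivative (\<lambda>t. k3 t / k2 t) (at s within I) \<and>
              (f has_real_derivative - k1 s * (k3 s / k2 s)) (at s within I)))"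
proof -
  define r where "r = (\<lambda>t. k3 t / k2 t)"
  have nz: "k1 s \<noteq> 0" "k2 s \<noteq> 0" "k3 s \<noteq> 0" if "s \<in> I" for s
    using assms(8)[OF that] by auto
  have nontriv: "at s within I \<noteq> bot" if "s \<in> I" for s
    using interval_at_within_nontrivial[OF assms(1,2) that] .
  have sq: "e1 * e1 = 1" "e2 * e2 = 1" and e_nz: "e1 \<noteq> 0" "e2 \<noteq> 0"
    using assms(4) by (auto simp: frenet_frame_def)
  have mink_frame:
    "mink (T s) (T s) = 1" "mink (N s) (N s) = e1" "mink (B1 s) (B1 s) = - e1 * e2"
    "mink (B2 s) (B2 s) = e2" "mink (T s) (N s) = 0" "mink (T s) (B1 s) = 0"
    "mink (T s) (B2 s) = 0" "mink (N s) (B1 s) = 0" "mink (N s) (B2 s) = 0"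
    "mink (B1 s) (B2 s) = 0" if "s \<in> I" for s
    using assms(4) that by (auto simp: frenet_frame_def)
  have frenet:
    "(T has_vector_derivative k1 s *\<^sub>R N s) (at s within I)"
    "(N has_vector_derivative (- e1 * k1 s) *\<^sub>R T s + k2 s *\<^sub>R B1 s) (at s within I)"
    "(B1 has_vector_derivative (e2 * k2 s) *\<^sub>R N s + k3 s *\<^sub>R B2 s) (at s within I)"
    "(B2 has_vector_derivative (e1 * k3 s) *\<^sub>R B1 s) (at s within I)" if "s \<in> I" for s
    using assms(4) that unfolding frenet_frame_def by blast+
  have r_C1: "Cn_on 1 r I"
    using Cn_on_1_mult[OF assms(7) Cn_on_1_inverse[OF assms(6)]] nz(2)
    by (simp add: r_def divide_inverse)
  then obtain r' where r': "\<And>s. s \<in> I \<Longrightarrow> (r has_real_derivative r' s) (at s within I)"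
    by (auto simp: Cn_on_1_iff)
  have vd: "vector_derivative r (at s within I) = r' s" if "s \<in> I" for s
    using r'[OF that] nontriv[OF that]
    by (simp add: has_real_derivative_iff_has_vector_derivative vector_derivative_within)
  have k1r_C1: "Cn_on 1 (\<lambda>s. - k1 s * r s) I"
  proof -
    have "Cn_on 1 (\<lambda>_. - 1 :: real) I"
      unfolding Cn_on_1_iff by (intro exI[of _ "\<lambda>_. 0"]) auto
    from Cn_on_1_mult[OF this Cn_on_1_mult[OF assms(5) r_C1]] show ?thesis
      by simp
  qed

  have "B2_slant_helix I B2 \<longleftrightarrow>
    (\<exists>f. Cn_on 2 f I \<and>
       (\<forall>s\<in>I. f s * k1 s = e1 * r' s \<and> (f has_real_derivative - k1 s * r s) (at s within I)))"
    (is "_ \<longleftrightarrow> (\<exists>f. ?P f)")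
  proof
    assume "B2_slant_helix I B2"
    then obtain U c where "U \<noteq> 0" and c: "\<And>s. s \<in> I \<Longrightarrow> mink (B2 s) U = c"
      by (auto simp: B2_slant_helix_def)
    note dU = has_real_derivative_mink_left[where U = U]
    \<comment> \<open>An identity valid on \<open>I\<close> alone may be differentiated, since all derivatives are taken
      within \<open>I\<close>.\<close>
    have deriv_on_I: "D = g'"
      if "s \<in> I" "\<And>t. t \<in> I \<Longrightarrow> h t = g t" "(h has_real_derivative D) (at s within I)"
        "(g has_real_derivative g') (at s within I)" for s D g' and g h :: "real \<Rightarrow> real"
    proof -
      have "(g has_real_derivative D) (at s within I)"
        by (rule has_field_derivative_transform_within[OF that(3) zero_less_one that(1)]) (rule that(2))
      then show ?thesis
        using that(4) has_real_derivative_within_unique[OF nontriv[OF that(1)]] by blast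
    qed
    have b: "mink (B1 s) U = 0" if s: "s \<in> I" for s
      using deriv_on_I[OF s c dU[OF frenet(4)[OF s]] DERIV_const] nz[OF s] e_nz
      by (simp add: mink_left_simps)
    have n: "mink (N s) U = - e2 * c * r s" if s: "s \<in> I" for s
    proof -
      have "e2 * k2 s * mink (N s) U + k3 s * c = 0"
        using deriv_on_I[OF s b dU[OF frenet(3)[OF s]] DERIV_const] c[OF s]
        by (simp add: mink_left_simps)
      \<comment> \<open>Multiplying by \<open>e2\<close> isolates \<open>mink (N s) U\<close>, because \<open>e2\<close> is its own inverse.\<close>
      then have "(e2 * e2) * k2 s * mink (N s) U = - e2 * c * k3 s"
        by algebra
      then show ?thesis
        using nz[OF s] by (simp add: sq r_def field_simps)
    qed
    have t: "e1 * k1 s * mink (T s) U = e2 * c * r' s" if s: "s \<in> I" for s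
      using deriv_on_I[OF s n dU[OF frenet(2)[OF s]] DERIV_cmult[OF r'[OF s]]] b[OF s]
      by (simp add: mink_left_simps)
    have "c \<noteq> 0"
    proof
      assume "c = 0"
      obtain s where s: "s \<in> I"
        using assms(2) interior_subset by blast
      have "U = 0"
        using mink_orthogonal_frame_eq_0[of "T s" "N s" "B1 s" "B2 s" U]
          mink_frame[OF s] b[OF s] n[OF s] t[OF s] c[OF s] nz[OF s] e_nz \<open>c = 0\<close>
        by simp
      with \<open>U \<noteq> 0\<close> show False ..
    qed
    define f where "f = (\<lambda>s. e2 / c * mink (T s) U)"
    have f': "(f has_real_derivative - k1 s * r s) (at s within I)" if s: "s \<in> I" for s
    proof -
      have "(f has_real_derivative e2 / c * (k1 s * mink (N s) U)) (at s within I)"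
        unfolding f_def using DERIV_cmult[OF dU[OF frenet(1)[OF s]], of "e2 / c"] by (simp add: mink_left_simps)
      also have "e2 / c * (k1 s * mink (N s) U) = - (e2 * e2) * k1 s * r s"
        using \<open>c \<noteq> 0\<close> by (simp add: n[OF s])
      finally show ?thesis
        by (simp add: sq)
    qed
    have "f s * k1 s = e1 * r' s" if s: "s \<in> I" for s
    proof -
      have "f s * k1 s = (e1 * e1) * (e2 / c * mink (T s) U * k1 s)"
        by (simp add: f_def sq)
      also have "\<dots> = e1 * e2 / c * (e1 * k1 s * mink (T s) U)"
        by (simp add: field_simps)
      also have "\<dots> = e1 * (e2 * e2) * r' s"
        using \<open>c \<noteq> 0\<close> by (simp add: t[OF s])
      finally show ?thesis
        by (simp add: sq)
    qed
    with f' Cn_on_2I[OF f' k1r_C1] show "\<exists>f. ?P f"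
      by blast
  next
    assume "\<exists>f. ?P f"
    then obtain f where
      f: "f s * k1 s = e1 * r' s" and
      f': "(f has_vector_derivative - k1 s * r s) (at s within I)" if "s \<in> I" for s
      by (auto simp: has_real_derivative_iff_has_vector_derivative)
    define V where "V = (\<lambda>s. f s *\<^sub>R T s - (e1 * r s) *\<^sub>R N s + B2 s)"
    have V': "(V has_vector_derivative 0) (at s within I)" if s: "s \<in> I" for s
    proof -
      have er': "((\<lambda>s. e1 * r s) has_real_derivative e1 * r' s) (at s within I)"
        using DERIV_cmult[OF r'[OF s]] .
      have "(V has_vector_derivative
          (f s *\<^sub>R (k1 s *\<^sub>R N s) + (- k1 s * r s) *\<^sub>R T s)
          - ((e1 * r s) *\<^sub>R ((- e1 * k1 s) *\<^sub>R T s + k2 s *\<^sub>R B1 s) + (e1 * r' s) *\<^sub>R N s)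
          + (e1 * k3 s) *\<^sub>R B1 s) (at s within I)"
        unfolding V_def
        by (intro has_vector_derivative_add has_vector_derivative_diff
            has_vector_derivative_scaleR frenet[OF s] er')
          (use f'[OF s] in \<open>simp add: has_real_derivative_iff_has_vector_derivative\<close>)
      \<comment> \<open>Collected by frame vectors, the coefficients are the first equation for \<open>f\<close>, a term that
        the second equation cancels up to \<open>e1 * e1 = 1\<close>, and the definition of \<open>r\<close>.\<close>
      also have "(f s *\<^sub>R (k1 s *\<^sub>R N s) + (- k1 s * r s) *\<^sub>R T s)
          - ((e1 * r s) *\<^sub>R ((- e1 * k1 s) *\<^sub>R T s + k2 s *\<^sub>R B1 s) + (e1 * r' s) *\<^sub>R N s)
          + (e1 * k3 s) *\<^sub>R B1 s
        = (f s * k1 s - e1 * r' s) *\<^sub>R N s + ((e1 * e1 - 1) * (k1 s * r s)) *\<^sub>R T s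
          + (e1 * (k3 s - r s * k2 s)) *\<^sub>R B1 s"
        by (simp add: algebra_simps)
      also have "\<dots> = 0"
        using nz[OF s] by (simp add: f[OF s] sq r_def)
      finally show ?thesis .
    qed
    have "convex I"
      using assms(1) by (rule is_interval_convex)
    then obtain W where W: "\<And>s. s \<in> I \<Longrightarrow> V s = W"
      using has_vector_derivative_zero_constant[OF _ V'] by blast
    have W_B2: "mink (B2 s) W = e2" if s: "s \<in> I" for s
    proof -
      have "mink (V s) (B2 s) = e2"
        by (simp add: V_def mink_left_simps mink_frame[OF s])
      then show ?thesis
        by (simp add: W[OF s] mink_commute)
    qed
    obtain s where "s \<in> I"
      using assms(2) interior_subset by blast
    then have "W \<noteq> 0"
      using W_B2 e_nz by (auto simp: mink_def)
    then obtain a where "a *\<^sub>R W \<noteq> 0" "mink (a *\<^sub>R W) (a *\<^sub>R W) \<in> {1, - 1, 0}"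
      by (rule mink_normalise)
    moreover have "mink (B2 s) (a *\<^sub>R W) = a * e2" if "s \<in> I" for s
      using that by (simp add: mink_scaleR_right W_B2)
    ultimately show "B2_slant_helix I B2"
      unfolding B2_slant_helix_def by blast
  qed
  then show ?thesis
    using vd by (simp add: r_def)
qed

end
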